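(* Let $f:\mathbb R^n\to\mathbb R^n$ be an affine function. Let $\Sigma\in\mathbb R^{n\times n}$ be positive definite and let $\alpha=\mathcal N(m_\alpha,\Sigma)$ and $\beta=\mathcal N(m_\beta,\Sigma)$ be Gaussian distributions on $\mathbb R^n$. Let $\delta>0$, and let $\alpha_i=\mathcal N(m_{\alpha_i},\Sigma)$, $i=1,\dots,N$, and $\beta_j=\mathcal N(m_{\beta_j},\Sigma)$, $j=1,\dots,K$, where the means $m_{\alpha_i}$, $m_{\beta_j}$ are uniformly distributed in $B(m_\alpha,\delta)$ and $B(m_\beta,\delta)$, respectively. Then $$d_M(f(m_\alpha),f(m_\beta))=d_{\mathrm{WM}}(f_\sharp\alpha,f_\sharp\beta),$$ where $d_M$ is computed with respect to the neighborhoods $\{f(m_{\alpha_i})\}_{i=1}^N$, $\{f(m_{\beta_j})\}_{j=1}^K$ and $d_{\mathrm{WM}}$ with respect to the neighborhoods $\{f_\sharp\alpha_i\}_{i=1}^N$, $\{f_\sharp\beta_j\}_{j=1}^K$.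
   Context: Notation: $B(m,\delta)=\{x\in\mathbb R^n:\|x-m\|\le\delta\}$; $\dagger$ is the Moore–Penrose pseudo-inverse; $T_\sharp\mu$ is the pushforward. Optimal transport: for probability measures $\mu,\nu$ on $\mathbb R^n$ with finite second moments, $T_\mu^\nu$ is the optimal transport map, i.e. the minimizer of $\int\|T(x)-x\|^2d\mu(x)$ over measurable $T$ with $T_\sharp\mu=\nu$, and $g_\mu^\nu=T_\mu^\nu-\mathrm{id}\in L^2(\mu)=L^2(\mu;\mathbb R^n)$; $\langle\psi,\varphi\rangle_\mu=\int\psi\cdot\varphi\,d\mu$. Wasserstein Mahalanobis distance: given a measure $\mu$ and neighborhood measures $\mu_1,\dots,\mu_L$, put $N_\mu=\{g_\mu^{\mu_i}\}_{i=1}^L$, $F_{N_\mu}=\frac1L\sum_{i=1}^L g_\mu^{\mu_i}\langle g_\mu^{\mu_i},\cdot\rangle_\mu$ on $L^2(\mu)$, $B_{ij}=\langle F_{N_\mu}g_\mu^{\mu_j},g_\mu^{\mu_i}\rangle_\mu$, and $F^\dagger_{N_\mu}=\sum_{i,j=1}^L B^\dagger_{ij}\,g_\mu^{\mu_i}\langle g_\mu^{\mu_j},\cdot\rangle_\mu$. For $\mu,\nu$ with given neighborhoods, $$d_{\mathrm{WM}}^2(\mu,\nu)=\tfrac12\big(\langle g_\mu^\nu,F^\dagger_{N_\mu}g_\mu^\nu\rangle_\mu+\langle g_\nu^\mu,F^\dagger_{N_\nu}g_\nu^\mu\rangle_\nu\big).$$ Euclidean Mahalanobis distance: $d_M^2(f(m_\alpha),f(m_\beta))=\frac12(f(m_\alpha)-f(m_\beta))^\top(C^\dagger_{f(m_\beta)}+C^\dagger_{f(m_\alpha)})(f(m_\alpha)-f(m_\beta))$,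 where $C_{f(m_\beta)}=\frac1K\sum_{j=1}^K(f(m_{\beta_j})-f(m_\beta))(f(m_{\beta_j})-f(m_\beta))^\top$ and $C_{f(m_\alpha)}=\frac1N\sum_{i=1}^N(f(m_{\alpha_i})-f(m_\alpha))(f(m_{\alpha_i})-f(m_\alpha))^\top$. *)

theory Defs
  imports "HOL-Probability.Probability"
begin

definition positive_definite :: "real^'n^'n \<Rightarrow> bool" where
  "positive_definite A \<longleftrightarrow> transpose A = A \<and> (\<forall>x. x \<noteq> 0 \<longrightarrow> x \<bullet> (A *v x) > 0)"

text \<open>The four Penrose conditions; they determine the pseudo-inverse uniquely.\<close>

definition is_pinv :: "real^'n^'m \<Rightarrow> real^'m^'n \<Rightarrow> bool" where
  "is_pinv A X \<longleftrightarrow>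
     A ** X ** A = A \<and> X ** A ** X = X \<and>
     transpose (A ** X) = A ** X \<and> transpose (X ** A) = X ** A"

definition pinv :: "real^'n^'m \<Rightarrow> real^'m^'n" where
  "pinv A = (THE X. is_pinv A X)"

text \<open>Meaningful for positive definite \<open>\<Sigma>\<close> only: degenerate Gaussians have no density and arise
  as pushforwards instead.\<close>

definition gaussian :: "real^'n \<Rightarrow> real^'n^'n \<Rightarrow> (real^'n) measure" where
  "gaussian m \<Sigma> = density lborel (\<lambda>x. ennreal
     (exp (- ((x - m) \<bullet> (matrix_inv \<Sigma> *v (x - m))) / 2) / sqrt ((2 * pi) ^ CARD('n) * det \<Sigma>)))"

text \<open>The quadratic cost is a nonnegative integral, so that a map of infinite cost is never
  counted as cheap.\<close>

definition transport_cost :: "(real^'n) measure \<Rightarrow> (real^'n \<Rightarrow> real^'n) \<Rightarrow> ennreal" where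
  "transport_cost \<mu> T = (\<integral>\<^sup>+x. ennreal ((norm (T x - x))\<^sup>2) \<partial>\<mu>)"

definition is_ot_map :: "(real^'n) measure \<Rightarrow> (real^'n) measure \<Rightarrow> (real^'n \<Rightarrow> real^'n) \<Rightarrow> bool" where
  "is_ot_map \<mu> \<nu> T \<longleftrightarrow>
     T \<in> borel_measurable borel \<and> distr \<mu> borel T = \<nu> \<and>
     (\<forall>S. S \<in> borel_measurable borel \<and> distr \<mu> borel S = \<nu> \<longrightarrow> transport_cost \<mu> T \<le> transport_cost \<mu> S)"

text \<open>An optimal map is determined at most up to \<open>\<mu>\<close>-null sets, so a representative is chosen.
  Below, elements of \<open>L\<^sup>2(\<mu>)\<close> are likewise represented by functions; only the integrals
  \<open>l2_inner\<close> are ever used, and these do not depend on the representatives.\<close>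

definition ot_map :: "(real^'n) measure \<Rightarrow> (real^'n) measure \<Rightarrow> real^'n \<Rightarrow> real^'n" where
  "ot_map \<mu> \<nu> = (SOME T. is_ot_map \<mu> \<nu> T)"

definition ot_disp :: "(real^'n) measure \<Rightarrow> (real^'n) measure \<Rightarrow> real^'n \<Rightarrow> real^'n" where
  "ot_disp \<mu> \<nu> = (\<lambda>x. ot_map \<mu> \<nu> x - x)"

definition l2_inner :: "(real^'n) measure \<Rightarrow> (real^'n \<Rightarrow> real^'n) \<Rightarrow> (real^'n \<Rightarrow> real^'n) \<Rightarrow> real" where
  "l2_inner \<mu> \<psi> \<phi> = (\<integral>x. \<psi> x \<bullet> \<phi> x \<partial>\<mu>)"

text \<open>A neighborhood is a family indexed by a finite type \<open>'k\<close>; its size is \<open>CARD('k)\<close>,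
  and repetitions are allowed.\<close>

definition wm_F ::
  "(real^'n) measure \<Rightarrow> ('k::finite \<Rightarrow> (real^'n) measure) \<Rightarrow> (real^'n \<Rightarrow> real^'n) \<Rightarrow> real^'n \<Rightarrow> real^'n" where
  "wm_F \<mu> \<mu>s \<phi> =
     (\<lambda>x. (1 / real CARD('k)) *\<^sub>R
            (\<Sum>i\<in>UNIV. l2_inner \<mu> (ot_disp \<mu> (\<mu>s i)) \<phi> *\<^sub>R ot_disp \<mu> (\<mu>s i) x))"

definition wm_B :: "(real^'n) measure \<Rightarrow> ('k::finite \<Rightarrow> (real^'n) measure) \<Rightarrow> real^'k^'k" where
  "wm_B \<mu> \<mu>s =
     (\<chi> i j. l2_inner \<mu> (wm_F \<mu> \<mu>s (ot_disp \<mu> (\<mu>s j))) (ot_disp \<mu> (\<mu>s i)))"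

definition wm_F_pinv ::
  "(real^'n) measure \<Rightarrow> ('k::finite \<Rightarrow> (real^'n) measure) \<Rightarrow> (real^'n \<Rightarrow> real^'n) \<Rightarrow> real^'n \<Rightarrow> real^'n" where
  "wm_F_pinv \<mu> \<mu>s \<phi> =
     (\<lambda>x. \<Sum>i\<in>UNIV. \<Sum>j\<in>UNIV.
            (pinv (wm_B \<mu> \<mu>s) $ i $ j * l2_inner \<mu> (ot_disp \<mu> (\<mu>s j)) \<phi>) *\<^sub>R ot_disp \<mu> (\<mu>s i) x)"

definition wm_dist ::
  "(real^'n) measure \<Rightarrow> ('k::finite \<Rightarrow> (real^'n) measure) \<Rightarrow>
   (real^'n) measure \<Rightarrow> ('l::finite \<Rightarrow> (real^'n) measure) \<Rightarrow> real" where
  "wm_dist \<mu> \<mu>s \<nu> \<nu>s = sqrt (1 / 2 *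
     (l2_inner \<mu> (ot_disp \<mu> \<nu>) (wm_F_pinv \<mu> \<mu>s (ot_disp \<mu> \<nu>)) +
      l2_inner \<nu> (ot_disp \<nu> \<mu>) (wm_F_pinv \<nu> \<nu>s (ot_disp \<nu> \<mu>))))"

definition local_cov :: "real^'n \<Rightarrow> ('k::finite \<Rightarrow> real^'n) \<Rightarrow> real^'n^'n" where
  "local_cov p ps =
     (\<chi> a b. (1 / real CARD('k)) * (\<Sum>i\<in>UNIV. (ps i - p) $ a * (ps i - p) $ b))"

definition mahalanobis_dist ::
  "real^'n \<Rightarrow> ('k::finite \<Rightarrow> real^'n) \<Rightarrow> real^'n \<Rightarrow> ('l::finite \<Rightarrow> real^'n) \<Rightarrow> real" where
  "mahalanobis_dist p ps q qs =
     sqrt (1 / 2 * ((p - q) \<bullet> ((pinv (local_cov q qs) + pinv (local_cov p ps)) *v (p - q))))"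

end

theory Submission
  imports Defs
begin

text \<open>
  Since \<open>f\<close> is affine and all the Gaussians share the covariance \<open>\<Sigma>\<close>, every measure that occurs is a
  translate of every other: \<open>f\<^sub>\<sharp>N(m',\<Sigma>)\<close> is \<open>f\<^sub>\<sharp>N(m,\<Sigma>)\<close> translated by \<open>f m' - f m\<close>. Between two translates
  of a probability measure with finite mean, the translation is the only optimal map up to null sets:
  any transport map \<open>S\<close> has mean displacement \<open>v\<close>, so its cost exceeds \<open>(norm v)\<^sup>2\<close> by the variance of
  its displacement (\<open>pushforward_translation_cheap_imp_AE\<close>, \<open>ot_disp_translation\<close>). This needs no density, so it
  also covers the degenerate measures that a singular linear part of \<open>f\<close> produces.

  Hence all the displacements are almost everywhere constant, the inner products of \<open>L\<^sup>2\<close> become those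
  of Euclidean space, and the Wasserstein distance is a statement about matrices. Let \<open>V\<close> have the
  columns \<open>f m\<^sub>i - f m\<close> and let \<open>C\<close> be the local covariance, a positive multiple of \<open>V V\<^sup>T\<close>. Then
  \<open>B = V\<^sup>T C V\<close>, the operator \<open>F\<^sup>\<dagger>\<close> acts on constants as \<open>V B\<^sup>\<dagger> V\<^sup>T\<close>, and \<open>V B\<^sup>\<dagger> V\<^sup>T = C\<^sup>\<dagger>\<close>
  (\<open>pinv_gram_sandwich\<close>, applied in \<open>wm_F_pinv_form_AE_const\<close>). The two quadratic forms of the
  Wasserstein distance thus agree one by one with those of the Euclidean one.

  What the argument needs of a Gaussian is total mass one and a finite first moment. Both follow from
  whitening (\<open>gaussian_whitening\<close>): a matrix that turns \<open>\<Sigma>\<close> into the identity maps the Gaussian to the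
  standard one, which is a product of one-dimensional densities. This uses the change of variables
  formula for linear maps, which is proved here for an arbitrary finite index type by decomposing
  into elementary matrices (\<open>nn_integral_lborel_matrix\<close>).
\<close>

section \<open>Moore-Penrose inverses and Gram matrices\<close>

text \<open>
  For a Penrose inverse \<open>X\<close> the products \<open>A X\<close> and \<open>X A\<close> are the orthogonal projections onto the column
  space and the row space of \<open>A\<close>, so they are the same for every \<open>X\<close>; and \<open>X = X A X\<close> is recovered from them.
\<close>

lemma is_pinv_unique:
  fixes A :: "real^'n^'m"
  assumes X: "is_pinv A X" and Y: "is_pinv A Y"
  shows "X = Y"
proof -
  have A: "A ** X ** A = A" "A ** Y ** A = A" and X2: "X ** A ** X = X" and Y2: "Y ** A ** Y = Y"
    and sX: "transpose (A ** X) = A ** X" "transpose (X ** A) = X ** A"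
    and sY: "transpose (A ** Y) = A ** Y" "transpose (Y ** A) = Y ** A"
    using X Y by (auto simp: is_pinv_def)
  have "A ** X = transpose (A ** Y ** A ** X)"
    using A sX by (simp add: matrix_mul_assoc)
  also have "\<dots> = transpose (A ** X) ** transpose (A ** Y)"
    by (simp add: matrix_transpose_mul matrix_mul_assoc)
  also have "\<dots> = A ** Y"
    using A sX sY by (simp add: matrix_mul_assoc)
  finally have AX: "A ** X = A ** Y" .
  have "X ** A = transpose (X ** (A ** Y ** A))"
    using A sX by simp
  also have "\<dots> = transpose (Y ** A) ** transpose (X ** A)"
    by (simp add: matrix_transpose_mul matrix_mul_assoc)
  also have "\<dots> = Y ** A"
    using A sX sY by (metis matrix_mul_assoc)
  finally have XA: "X ** A = Y ** A" .
  have "X = X ** (A ** X)" using X2 by (simp add: matrix_mul_assoc)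
  also have "\<dots> = Y ** A ** Y" using AX XA by (simp add: matrix_mul_assoc)
  finally show ?thesis using Y2 by simp
qed

lemma pinv_eqI: "is_pinv A X \<Longrightarrow> pinv A = X"
  unfolding pinv_def by (rule the_equality) (auto intro: is_pinv_unique)

lemma matrix_mul_add_diff_distrib:
  fixes X Y :: "real^'a^'b" and Z :: "real^'d^'a" and W :: "real^'b^'c"
  shows matrix_add_rdistrib: "(X + Y) ** Z = X ** Z + Y ** Z"
    and matrix_diff_rdistrib: "(X - Y) ** Z = X ** Z - Y ** Z"
    and matrix_diff_ldistrib: "W ** (X - Y) = W ** X - W ** Y"
  by (simp_all add: matrix_matrix_mult_def vec_eq_iff algebra_simps sum.distrib sum_subtractf)

lemma transpose_diff:
  fixes X Y :: "real^'a^'b"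
  shows "transpose (X - Y) = transpose X - transpose Y"
  by (simp add: transpose_def vec_eq_iff)

text \<open>
  The orthogonal projection onto the kernel. It repairs the singularity of \<open>A\<close> in the construction of
  the pseudo-inverse below.
\<close>

lemma kernel_projection_exists:
  fixes A :: "real^'n^'n"
  assumes sym: "transpose A = A"
  obtains P where "transpose P = P" "P ** P = P" "A ** P = 0" "\<And>x. A *v x = 0 \<Longrightarrow> P *v x = x"
proof -
  define N where "N = {x. A *v x = 0}"
  have N: "subspace N"
    unfolding N_def by (auto simp: subspace_def matrix_vector_right_distrib matrix_vector_mult_scaleR)
  have "\<exists>y. y \<in> N \<and> (\<forall>w\<in>N. (x - y) \<bullet> w = 0)" for x
  proof -
    obtain y z where "y \<in> span N" "\<And>w. w \<in> span N \<Longrightarrow> orthogonal z w" "x = y + z"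
      using orthogonal_subspace_decomp_exists[of N x] by blast
    then show ?thesis
      using span_eq_iff[THEN iffD2, OF N] by (intro exI[of _ y]) (auto simp: orthogonal_def)
  qed
  then obtain p where pN: "\<And>x. p x \<in> N" and orth: "\<And>x w. w \<in> N \<Longrightarrow> (x - p x) \<bullet> w = 0"
    by metis
  have uniq: "p x = y" if "y \<in> N" "\<And>w. w \<in> N \<Longrightarrow> (x - y) \<bullet> w = 0" for x y
  proof -
    have "p x - y \<in> N" using N pN that by (simp add: subspace_diff)
    then have "(p x - y) \<bullet> (p x - y) = 0"
      using that(2)[of "p x - y"] orth[of "p x - y" x]
      by (simp add: inner_diff_left)
    then show ?thesis by simp
  qed
  have lin: "linear p"
  proof (rule linearI)
    show "p (x + y) = p x + p y" for x y
    proof (rule uniq)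
      show "p x + p y \<in> N" using N pN by (simp add: subspace_add)
      show "(x + y - (p x + p y)) \<bullet> w = 0" if "w \<in> N" for w
        using orth[OF that, of x] orth[OF that, of y]
        by (simp add: inner_diff_left inner_add_left)
    qed
    show "p (c *\<^sub>R x) = c *\<^sub>R p x" for x c
    proof (rule uniq)
      show "c *\<^sub>R p x \<in> N" using N pN by (simp add: subspace_scale)
      show "(c *\<^sub>R x - c *\<^sub>R p x) \<bullet> w = 0" if "w \<in> N" for w
        using orth[OF that, of x] by (simp add: inner_diff_left)
    qed
  qed
  define P where "P = matrix p"
  have P: "P *v x = p x" for x
    unfolding P_def using lin by (simp add: matrix_works)
  have fx: "p x = x" if "x \<in> N" for x
    using that by (intro uniq) auto
  have symp: "p x \<bullet> y = x \<bullet> p y" for x y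
    using orth[OF pN, of x y] orth[OF pN, of y x]
    by (simp add: inner_diff_left inner_diff_right inner_commute)
  show thesis
  proof (rule that[of P])
    have "(transpose P *v x) \<bullet> y = (P *v x) \<bullet> y" for x y
      using symp by (simp add: P dot_lmul_matrix)
    then have "transpose P *v x = P *v x" for x
      using vector_eq_rdot by blast
    then show "transpose P = P"
      by (simp add: matrix_eq)
    show "P ** P = P"
      by (simp add: matrix_eq P fx pN flip: matrix_vector_mul_assoc)
    show "A ** P = 0"
      using pN by (simp add: matrix_eq P N_def flip: matrix_vector_mul_assoc)
    show "P *v x = x" if "A *v x = 0" for x
      using that fx by (simp add: P N_def)
  qed
qed

text \<open>
  A symmetric \<open>A\<close> vanishes on its kernel and preserves the orthogonal complement. Adding the projection \<open>P\<close>
  onto the kernel therefore makes it invertible, and \<open>(A + P)\<^sup>-\<^sup>1 - P\<close> inverts \<open>A\<close> on the complement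
  and vanishes on the kernel. Existence is needed because \<^const>\<open>pinv\<close> is a definite description.
\<close>

lemma is_pinv_pinv_symmetric:
  fixes A :: "real^'n^'n"
  assumes sym: "transpose A = A"
  shows "is_pinv A (pinv A)"
proof -
  obtain P where PT: "transpose P = P" and PP: "P ** P = P" and AP: "A ** P = 0"
    and fx: "\<And>x. A *v x = 0 \<Longrightarrow> P *v x = x"
    using kernel_projection_exists[OF sym] by blast
  have PA: "P ** A = 0"
    using arg_cong[OF AP, of transpose] by (simp add: matrix_transpose_mul sym PT)
       (simp add: transpose_def vec_eq_iff)
  have "x = 0" if x: "(A + P) *v x = 0" for x
  proof -
    have "P *v x = (P ** (A + P)) *v x"
      by (simp add: matrix_add_ldistrib PA PP)
    also have "\<dots> = 0" using x by (simp flip: matrix_vector_mul_assoc)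
    finally have "P *v x = 0" .
    moreover from this have "A *v x = 0"
      using x by (simp add: matrix_vector_mult_add_rdistrib)
    ultimately show ?thesis using fx by simp
  qed
  then obtain Q where Q1: "Q ** (A + P) = mat 1"
    using matrix_left_invertible_ker[of "A + P"] by blast
  then have Q2: "(A + P) ** Q = mat 1"
    by (simp add: matrix_left_right_inverse)
  have QP: "Q ** P = P"
  proof -
    have "Q ** P = Q ** (A + P) ** P"
      by (simp add: matrix_mul_assoc[symmetric] matrix_add_rdistrib AP PP)
    then show ?thesis using Q1 by simp
  qed
  have PQ: "P ** Q = P"
  proof -
    have "P ** Q = P ** ((A + P) ** Q)"
      by (simp add: matrix_mul_assoc matrix_add_ldistrib PA PP)
    then show ?thesis using Q2 by simp
  qed
  have AQ: "A ** Q = mat 1 - P"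
    using Q2 PQ by (simp add: matrix_add_rdistrib algebra_simps)
  have QA: "Q ** A = mat 1 - P"
    using Q1 QP by (simp add: matrix_add_ldistrib algebra_simps)
  have "is_pinv A (Q - P)"
    unfolding is_pinv_def
    by (simp add: matrix_diff_rdistrib matrix_diff_ldistrib transpose_diff AP PA AQ QA PT PQ PP)
  then show ?thesis
    using pinv_eqI by metis
qed

lemma inner_gram:
  fixes A :: "real^'k^'n"
  shows "x \<bullet> ((transpose A ** A) *v x) = (A *v x) \<bullet> (A *v x)"
  by (metis dot_lmul_matrix transpose_matrix_vector matrix_vector_mul_assoc inner_commute)

lemma matrix_eq_0_if_gram_0:
  fixes D :: "real^'k^'n"
  assumes "transpose D ** D = 0"
  shows "D = 0"
proof -
  have "D *v x = 0" for x
    using inner_gram[of x D] assms by simp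
  then show ?thesis by (simp add: matrix_eq)
qed

text \<open>
  Writing \<open>V\<^sup>+\<close> for the pseudo-inverse of \<open>V\<close> and taking \<open>c = 1\<close>, the middle matrix is \<open>B = (V\<^sup>T V)\<^sup>2\<close>, and
  \<open>V (V\<^sup>T V)\<^sup>+ (V\<^sup>T V)\<^sup>+ V\<^sup>T = (V V\<^sup>T)\<^sup>+\<close>. The proof avoids \<open>V\<^sup>+\<close>: a generalized inverse \<open>X\<close> of \<open>B\<close>
  is all it takes, because \<open>V X V\<^sup>T\<close> does not depend on its choice.
\<close>

lemma is_pinv_gram_sandwich:
  fixes V :: "real^'k^'n" and C :: "real^'n^'n" and X :: "real^'k^'k"
  assumes c: "c > 0" and C: "C = c *\<^sub>R (V ** transpose V)"
    and X: "transpose V ** C ** V ** X ** (transpose V ** C ** V) = transpose V ** C ** V"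
  shows "is_pinv C (V ** X ** transpose V)"
proof -
  define B where "B = transpose V ** C ** V"
  define G where "G = transpose V ** V"
  define Y where "Y = V ** X ** transpose V"
  note assoc = matrix_mul_assoc[symmetric]
  have scl: "(r *\<^sub>R S) ** T = r *\<^sub>R (S ** T)" "S ** (r *\<^sub>R T) = r *\<^sub>R (S ** T)"
    for r :: real and S :: "real^'a^'b" and T :: "real^'d^'a"
    by (simp_all add: matrix_matrix_mult_def vec_eq_iff sum_distrib_left algebra_simps)
  have B: "B = c *\<^sub>R (G ** G)"
    by (simp add: B_def C G_def scl assoc)
  have GT: "transpose G = G" by (simp add: G_def matrix_transpose_mul)
  have BT: "transpose B = B" by (simp add: B transpose_scalar matrix_transpose_mul GT)
  have CT: "transpose C = C" by (simp add: C transpose_scalar matrix_transpose_mul)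
  \<comment> \<open>The kernel of \<open>B\<close> is that of \<open>V\<close>: a real matrix vanishes as soon as its
    Gram matrix does, used twice.\<close>
  have cancel: "V ** Z = 0" if "B ** Z = 0" for Z :: "real^'k^'k"
  proof -
    have "G ** (G ** Z) = 0" using that c by (simp add: B scl assoc)
    then have "transpose (G ** Z) ** (G ** Z) = 0"
      by (simp add: matrix_transpose_mul GT assoc)
    then have "G ** Z = 0" by (rule matrix_eq_0_if_gram_0)
    then have "transpose (V ** Z) ** (V ** Z) = 0"
      by (simp add: matrix_transpose_mul G_def assoc)
    then show ?thesis by (rule matrix_eq_0_if_gram_0)
  qed
  have BXB: "B ** X ** B = B" using X by (simp add: B_def)
  have VXB: "V ** X ** B = V"
    using cancel[of "X ** B - mat 1"] BXB by (simp add: matrix_diff_ldistrib matrix_mul_assoc)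
  have "B ** transpose X ** B = B"
    using arg_cong[OF BXB, of transpose] by (simp add: matrix_transpose_mul BT assoc)
  then have "V ** transpose X ** B = V"
    using cancel[of "transpose X ** B - mat 1"] by (simp add: matrix_diff_ldistrib matrix_mul_assoc)
  from arg_cong[OF this, of transpose] have BXV: "B ** X ** transpose V = transpose V"
    by (simp add: matrix_transpose_mul BT assoc)
  have CYf: "C ** Y = V ** (c *\<^sub>R (G ** X ** transpose V))"
    by (simp add: C Y_def G_def scl assoc)
  have "transpose V ** (C ** Y) = B ** X ** transpose V"
    by (simp add: B_def Y_def assoc)
  with BXV have "transpose V ** (C ** Y) = transpose V" by simp
  from arg_cong[OF this, of transpose] have tCYV: "transpose (C ** Y) ** V = V"
    by (simp add: matrix_transpose_mul)
  \<comment> \<open>The columns of \<open>C Y\<close> lie in the range of \<open>V\<close>, which the transpose of \<open>C Y\<close> fixes; so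
    \<open>C Y\<close> equals its own Gram matrix and is symmetric. Transposed, the same works for \<open>Y C\<close>.\<close>
  have "transpose (C ** Y) ** (C ** Y) = C ** Y"
    using tCYV by (metis CYf matrix_mul_assoc)
  then have CYT: "transpose (C ** Y) = C ** Y"
    by (metis matrix_transpose_mul transpose_transpose)
  have YCV: "Y ** C ** V = V"
    using VXB by (simp add: B_def Y_def assoc)
  have "transpose (Y ** C) = V ** (c *\<^sub>R (transpose V ** transpose Y))"
    by (simp add: C CT matrix_transpose_mul transpose_scalar scl assoc)
  then have "(Y ** C) ** transpose (Y ** C) = transpose (Y ** C)"
    using YCV by (metis matrix_mul_assoc)
  then have YCT: "transpose (Y ** C) = Y ** C"
    by (metis matrix_transpose_mul transpose_transpose)
  have "C ** Y ** C = C"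
    using tCYV by (simp add: CYT) (metis C scl(2) matrix_mul_assoc)
  moreover have "Y ** C ** Y = Y"
    using YCV unfolding Y_def by (metis matrix_mul_assoc)
  ultimately show ?thesis
    using CYT YCT by (simp add: is_pinv_def Y_def)
qed

lemma pinv_gram_sandwich:
  fixes V :: "real^'k^'n"
  assumes c: "c > 0" and C: "C = c *\<^sub>R (V ** transpose V)"
  shows "pinv C = V ** pinv (transpose V ** C ** V) ** transpose V"
proof (rule pinv_eqI, rule is_pinv_gram_sandwich[OF c C])
  have "transpose C = C"
    unfolding C by (simp add: matrix_transpose_mul transpose_scalar)
  then have "transpose (transpose V ** C ** V) = transpose V ** C ** V"
    by (simp add: matrix_transpose_mul matrix_mul_assoc)
  from is_pinv_pinv_symmetric[OF this]
  show "transpose V ** C ** V ** pinv (transpose V ** C ** V) ** (transpose V ** C ** V)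
    = transpose V ** C ** V"
    by (simp add: is_pinv_def)
qed

section \<open>Linear change of variables\<close>

lemma measurable_matrix_vector [measurable]: "(*v) (A :: real^'n^'m) \<in> borel_measurable borel"
  by (intro borel_measurable_continuous_onI matrix_vector_mult_linear_continuous_on)

lemma nn_integral_lborel_translate:
  fixes g :: "'a::euclidean_space \<Rightarrow> ennreal"
  assumes [measurable]: "g \<in> borel_measurable borel"
  shows "(\<integral>\<^sup>+x. g (x + c) \<partial>lborel) = (\<integral>\<^sup>+x. g x \<partial>lborel)"
proof -
  have "(\<integral>\<^sup>+x. g x \<partial>lborel) = (\<integral>\<^sup>+x. g x \<partial>distr lborel borel ((+) c))"
    by (simp add: lborel_distr_plus)
  also have "\<dots> = (\<integral>\<^sup>+x. g (c + x) \<partial>lborel)"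
    by (subst nn_integral_distr) auto
  finally show ?thesis by (simp add: add.commute)
qed

text \<open>
  Fubini, with the integration along one basis direction performed first.
\<close>

lemma nn_integral_lborel_split_direction:
  fixes g :: "'a::euclidean_space \<Rightarrow> ennreal"
  assumes [measurable]: "g \<in> borel_measurable borel" and b: "b \<in> Basis"
  shows "(\<integral>\<^sup>+x. g x \<partial>lborel) =
    (\<integral>\<^sup>+y. (\<integral>\<^sup>+t. g ((\<Sum>e\<in>Basis - {b}. y e *\<^sub>R e) + t *\<^sub>R b) \<partial>lborel) \<partial>(\<Pi>\<^sub>M e\<in>Basis - {b}. lborel))"
proof -
  interpret product_sigma_finite "\<lambda>e::'a. lborel :: real measure"
    by standard
  have B: "(Basis :: 'a set) = insert b (Basis - {b})" using b by auto
  have meas: "(\<lambda>f. \<Sum>e\<in>Basis. f e *\<^sub>R e) \<in> (\<Pi>\<^sub>M e\<in>(Basis::'a set). (lborel::real measure)) \<rightarrow>\<^sub>M (borel :: 'a measure)"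
    by measurable
  have sum: "(\<Sum>e\<in>Basis. (y(b := t)) e *\<^sub>R e) = (\<Sum>e\<in>Basis - {b}. y e *\<^sub>R e) + t *\<^sub>R b" for y t
    by (subst B, subst sum.insert) (auto simp: add.commute intro!: sum.cong)
  have "(\<integral>\<^sup>+x. g x \<partial>lborel) = (\<integral>\<^sup>+f. g (\<Sum>e\<in>Basis. f e *\<^sub>R e) \<partial>(\<Pi>\<^sub>M e\<in>Basis. lborel))"
    by (subst lborel_eq) (simp add: nn_integral_distr meas)
  also have "\<dots> = (\<integral>\<^sup>+f. g (\<Sum>e\<in>Basis. f e *\<^sub>R e) \<partial>(\<Pi>\<^sub>M e\<in>insert b (Basis - {b}). lborel))"
    using B by simp
  also have "\<dots> = (\<integral>\<^sup>+y. (\<integral>\<^sup>+t. g (\<Sum>e\<in>Basis. (y(b := t)) e *\<^sub>R e) \<partial>lborel) \<partial>(\<Pi>\<^sub>M e\<in>Basis - {b}. lborel))"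
    using measurable_compose[OF meas assms(1)] B
    by (subst product_nn_integral_insert) (auto simp: comp_def)
  finally show ?thesis by (simp only: sum)
qed

text \<open>
  On each line in direction \<open>b\<close> the shear is a translation, because \<open>\<psi>\<close> is constant there.
\<close>

lemma nn_integral_lborel_shear:
  fixes g :: "'a::euclidean_space \<Rightarrow> ennreal" and \<psi> :: "'a \<Rightarrow> real"
  assumes [measurable]: "g \<in> borel_measurable borel" "\<psi> \<in> borel_measurable borel"
    and b: "b \<in> Basis" and \<psi>: "\<And>x t. \<psi> (x + t *\<^sub>R b) = \<psi> x"
  shows "(\<integral>\<^sup>+x. g (x + \<psi> x *\<^sub>R b) \<partial>lborel) = (\<integral>\<^sup>+x. g x \<partial>lborel)"
proof -
  have "(\<integral>\<^sup>+t. g (s + t *\<^sub>R b + \<psi> (s + t *\<^sub>R b) *\<^sub>R b) \<partial>lborel) = (\<integral>\<^sup>+t. g (s + t *\<^sub>R b) \<partial>lborel)" for s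
    using nn_integral_lborel_translate[of "\<lambda>t. g (s + t *\<^sub>R b)" "\<psi> s"]
    by (simp add: \<psi> scaleR_left_distrib add_ac)
  then show ?thesis
    using b by (subst (1 2) nn_integral_lborel_split_direction) auto
qed

lemma prod_Basis_cart: "(\<Prod>b\<in>(Basis :: (real^'n) set). h b) = (\<Prod>i\<in>UNIV. h (axis i 1))"
proof -
  have "(Basis :: (real^'n) set) = (\<lambda>i. axis i 1) ` UNIV"
    by (auto simp: Basis_vec_def)
  moreover have "inj (\<lambda>i::'n. axis i (1::real))"
    by (auto simp: inj_def axis_eq_axis)
  ultimately show ?thesis by (metis (mono_tags) prod.reindex_cong)
qed

lemma lborel_distr_permute_coordinates:
  fixes p :: "'n::finite \<Rightarrow> 'n"
  assumes p: "bij p"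
  shows "distr lborel borel (\<lambda>x::real^'n. \<chi> i. x $ p i) = lborel"
proof (rule lborel_eqI[symmetric])
  fix l u :: "real^'n"
  assume le: "\<And>b. b \<in> Basis \<Longrightarrow> l \<bullet> b \<le> u \<bullet> b"
  define q where "q = inv p"
  have pq: "p (q i) = i" "q (p i) = i" for i
    using p by (auto simp: q_def bij_def surj_f_inv_f)
  have [measurable]: "(\<lambda>x::real^'n. \<chi> i. x $ p i) \<in> borel_measurable borel"
    by (intro borel_measurable_continuous_onI continuous_intros)
  let ?r = "\<lambda>x::real^'n. \<chi> i. x $ q i"
  have lu: "l $ i \<le> u $ i" for i
    using le[of "axis i 1"] by (simp add: inner_axis)
  have box: "(\<lambda>x::real^'n. \<chi> i. x $ p i) -` box l u = box (?r l) (?r u)"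
    by (auto simp: mem_box_cart) (metis pq)+
  have "emeasure (distr lborel borel (\<lambda>x::real^'n. \<chi> i. x $ p i)) (box l u) = emeasure lborel (box (?r l) (?r u))"
    by (simp add: emeasure_distr box)
  also have "\<dots> = (\<Prod>b\<in>Basis. (?r u - ?r l) \<bullet> b)"
    using lu by (intro emeasure_lborel_box) (auto simp: Basis_vec_def inner_axis)
  also have "(\<Prod>b\<in>Basis. (?r u - ?r l) \<bullet> b) = (\<Prod>b\<in>Basis. (u - l) \<bullet> b)"
    using prod.reindex_bij_betw[of q UNIV UNIV "\<lambda>i. u $ i - l $ i"] p
    by (simp add: prod_Basis_cart inner_axis q_def bij_imp_bij_inv)
  finally show "emeasure (distr lborel borel (\<lambda>x::real^'n. \<chi> i. x $ p i)) (box l u)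
    = (\<Prod>b\<in>Basis. (u - l) \<bullet> b)" .
qed simp

lemma nn_integral_lborel_diagonal:
  fixes g :: "real^'n \<Rightarrow> ennreal" and A :: "real^'n^'n"
  assumes [measurable]: "g \<in> borel_measurable borel"
    and diag: "\<And>i j. i \<noteq> j \<Longrightarrow> A $ i $ j = 0" and A: "\<And>i. A $ i $ i \<noteq> 0"
  shows "ennreal \<bar>det A\<bar> * (\<integral>\<^sup>+x. g (A *v x) \<partial>lborel) = (\<integral>\<^sup>+x. g x \<partial>lborel)"
proof -
  define c where "c = (\<lambda>b::real^'n. (A *v b) \<bullet> b)"
  have Ab: "A *v axis i 1 = A $ i $ i *\<^sub>R axis i 1" for i
    unfolding matrix_vector_mult_basis using diag by (auto simp: vec_eq_iff column_def axis_def)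
  then have c_axis: "c (axis i 1) = A $ i $ i" for i
    by (simp add: c_def inner_axis)
  have c0: "c b \<noteq> 0" if "b \<in> Basis" for b
    using that A c_axis by (auto simp: Basis_vec_def)
  have "(c b * (x \<bullet> b)) *\<^sub>R b = (x \<bullet> b) *\<^sub>R (A *v b)" if "b \<in> Basis" for b x
    using that c_axis Ab by (auto simp: Basis_vec_def)
  then have "(\<Sum>b\<in>Basis. (c b * (x \<bullet> b)) *\<^sub>R b) = A *v (\<Sum>b\<in>Basis. (x \<bullet> b) *\<^sub>R b)" for x
    by (simp add: linear_sum[OF matrix_vector_mul_linear] matrix_vector_mult_scaleR)
  then have T: "(\<lambda>x. 0 + (\<Sum>b\<in>Basis. (c b * (x \<bullet> b)) *\<^sub>R b)) = (*v) A"
    by (simp add: euclidean_representation)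
  have d: "(\<Prod>b\<in>Basis. \<bar>c b\<bar>) = \<bar>det A\<bar>"
    using diag by (simp add: prod_Basis_cart c_axis det_diagonal abs_prod)
  have "(\<integral>\<^sup>+x. g x \<partial>lborel) = (\<integral>\<^sup>+x. g x \<partial>density (distr lborel borel ((*v) A)) (\<lambda>_. ennreal \<bar>det A\<bar>))"
    using lborel_affine_euclidean[of c 0] c0 unfolding T d by simp
  also have "\<dots> = ennreal \<bar>det A\<bar> * (\<integral>\<^sup>+x. g (A *v x) \<partial>lborel)"
    by (simp add: nn_integral_density nn_integral_cmult nn_integral_distr)
  finally show ?thesis by simp
qed

text \<open>
  Both sides are multiplicative in \<open>A\<close>, so elementary matrices suffice: diagonal matrices rescale boxes,
  transpositions permute their sides, and adding a multiple of one row to another is a shear.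
\<close>

lemma nn_integral_lborel_matrix:
  fixes g :: "real^'n \<Rightarrow> ennreal" and A :: "real^'n^'n"
  assumes g: "g \<in> borel_measurable borel" and A: "det A \<noteq> 0"
  shows "ennreal \<bar>det A\<bar> * (\<integral>\<^sup>+x. g (A *v x) \<partial>lborel) = (\<integral>\<^sup>+x. g x \<partial>lborel)"
proof -
  define P where "P = (\<lambda>A::real^'n^'n. det A \<noteq> 0 \<longrightarrow> (\<forall>g\<in>borel_measurable borel.
    ennreal \<bar>det A\<bar> * (\<integral>\<^sup>+x. g (A *v x) \<partial>lborel) = (\<integral>\<^sup>+x. g x \<partial>lborel)))"
  have "P A"
  proof (rule induct_matrix_elementary)
    fix A B :: "real^'n^'n"
    assume P: "P A" "P B"
    show "P (A ** B)"
      unfolding P_def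
    proof (intro impI ballI)
      fix g :: "real^'n \<Rightarrow> ennreal"
      assume "det (A ** B) \<noteq> 0" and g: "g \<in> borel_measurable borel"
      then have d: "det A \<noteq> 0" "det B \<noteq> 0" by (auto simp: det_mul)
      have "ennreal \<bar>det (A ** B)\<bar> * (\<integral>\<^sup>+x. g ((A ** B) *v x) \<partial>lborel) =
        ennreal \<bar>det A\<bar> * (ennreal \<bar>det B\<bar> * (\<integral>\<^sup>+x. g (A *v (B *v x)) \<partial>lborel))"
        by (simp add: det_mul abs_mult ennreal_mult mult.assoc matrix_vector_mul_assoc)
      also have "ennreal \<bar>det B\<bar> * (\<integral>\<^sup>+x. g (A *v (B *v x)) \<partial>lborel) = (\<integral>\<^sup>+x. g (A *v x) \<partial>lborel)"
        using P(2) d(2) measurable_compose[OF measurable_matrix_vector[of A] g] unfolding P_def by (auto simp: comp_def)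
      also have "ennreal \<bar>det A\<bar> * \<dots> = (\<integral>\<^sup>+x. g x \<partial>lborel)"
        using P(1) d(1) g unfolding P_def by auto
      finally show "ennreal \<bar>det (A ** B)\<bar> * (\<integral>\<^sup>+x. g ((A ** B) *v x) \<partial>lborel) = (\<integral>\<^sup>+x. g x \<partial>lborel)" .
    qed
  next
    show "P A" if "row i A = 0" for A i
      using that by (simp add: P_def det_zero_row)
  next
    fix A :: "real^'n^'n"
    assume diag: "\<And>i j. i \<noteq> j \<Longrightarrow> A $ i $ j = 0"
    show "P A"
      unfolding P_def using nn_integral_lborel_diagonal[OF _ diag]
      by (auto simp: det_diagonal[OF diag])
  next
    fix m n :: 'n assume "m \<noteq> n"
    let ?p = "Transposition.transpose m n"
    let ?A = "(\<chi> i j. mat 1 $ i $ ?p j) :: real^'n^'n"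
    have "?A *v x = (\<chi> i. x $ ?p i)" for x
    proof -
      have "i = ?p j \<longleftrightarrow> j = ?p i" for i j
        by (metis transpose_involutory)
      then have "(?A *v x) $ i = (\<Sum>j\<in>UNIV. if j = ?p i then x $ j else 0)" for i
        unfolding matrix_vector_mult_def vec_lambda_beta mat_def
        by (intro sum.cong) auto
      then show ?thesis by (simp add: vec_eq_iff)
    qed
    moreover have "\<bar>det ?A\<bar> = 1"
      using det_permute_columns[of ?p "mat 1 :: real^'n^'n"]
      by (simp add: permutes_swap_id sign_swap_id)
    ultimately show "P ?A"
      unfolding P_def
    proof (intro impI ballI)
      fix g :: "real^'n \<Rightarrow> ennreal"
      assume [measurable]: "g \<in> borel_measurable borel"
      have m: "(\<lambda>x::real^'n. \<chi> i. x $ ?p i) \<in> borel_measurable borel"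
        by (intro borel_measurable_continuous_onI continuous_intros)
      have "(\<integral>\<^sup>+x. g x \<partial>lborel) = (\<integral>\<^sup>+x. g x \<partial>distr lborel borel (\<lambda>x::real^'n. \<chi> i. x $ ?p i))"
        by (simp add: lborel_distr_permute_coordinates)
      also have "\<dots> = (\<integral>\<^sup>+x. g (\<chi> i. x $ ?p i) \<partial>lborel)"
        using m by (subst nn_integral_distr) auto
      finally show "ennreal \<bar>det ?A\<bar> * (\<integral>\<^sup>+x. g (?A *v x) \<partial>lborel) = (\<integral>\<^sup>+x. g x \<partial>lborel)"
        using \<open>\<And>x. ?A *v x = _ x\<close> \<open>\<bar>det ?A\<bar> = 1\<close> by simp
    qed
  next
    fix m n :: 'n and c :: real assume mn: "m \<noteq> n"
    let ?A = "(\<chi> i j. if i = m \<and> j = n then c else of_bool (i = j)) :: real^'n^'n"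
    have "?A *v x = x + (c * x $ n) *\<^sub>R axis m 1" for x
    proof -
      have "(?A *v x) $ i = (\<Sum>j\<in>UNIV. (if j = i then x $ j else 0) + (if j = n then (if i = m then c * x $ n else 0) else 0))" for i
        unfolding matrix_vector_mult_def using mn
        by (auto intro!: sum.cong)
      then show ?thesis
        by (auto simp: vec_eq_iff sum.distrib axis_def)
    qed
    moreover have "det ?A = 1"
    proof -
      have "?A = (\<chi> k. if k = m then row m (mat 1) + c *s row n (mat 1) else row k (mat 1))"
        using mn by (auto simp: vec_eq_iff row_def mat_def)
      then show ?thesis using det_row_operation[OF mn, of "mat 1 :: real^'n^'n" c] by simp
    qed
    moreover have "(\<integral>\<^sup>+x. g (x + (c * x $ n) *\<^sub>R axis m 1) \<partial>lborel) = (\<integral>\<^sup>+x. g x \<partial>lborel)"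
      if "g \<in> borel_measurable borel" for g :: "real^'n \<Rightarrow> ennreal"
    proof (rule nn_integral_lborel_shear[OF that])
      show "(\<lambda>x. c * x $ n) \<in> borel_measurable borel"
        by (intro borel_measurable_continuous_onI continuous_intros)
      show "axis m 1 \<in> (Basis :: (real^'n) set)" by simp
      show "c * (x + t *\<^sub>R axis m 1) $ n = c * x $ n" for x t
        using mn by (simp add: axis_def)
    qed
    ultimately show "P ?A" by (simp add: P_def)
  qed
  then show ?thesis using g A by (auto simp: P_def)
qed

section \<open>Gaussian measures\<close>

lemma matrix_inv_eqI:
  fixes A B :: "real^'n^'n"
  assumes "B ** A = mat 1"
  shows "matrix_inv A = B"
proof -
  have AB: "A ** B = mat 1" using assms by (simp add: matrix_left_right_inverse)
  then have "A ** matrix_inv A = mat 1 \<and> matrix_inv A ** A = mat 1"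
    unfolding matrix_inv_def
    using someI[of "\<lambda>A'. A ** A' = mat 1 \<and> A' ** A = mat 1" B] assms by simp
  then have "B ** A ** matrix_inv A = B" by (simp add: matrix_mul_assoc[symmetric])
  then show ?thesis using assms by simp
qed

lemma symmetric_inner:
  fixes A :: "real^'n^'n"
  assumes "transpose A = A"
  shows "(A *v x) \<bullet> y = x \<bullet> (A *v y)"
  using assms by (metis dot_lmul_matrix transpose_matrix_vector)

text \<open>
  Gram-Schmidt for the inner product \<open>x \<bullet> (A *v y)\<close>: the columns of \<open>C\<close> are a basis that is orthonormal with
  respect to it.
\<close>

lemma positive_definite_congruent_mat_1:
  fixes A :: "real^'n^'n"
  assumes A: "positive_definite A"
  obtains C :: "real^'n^'n" where "transpose C ** A ** C = mat 1"
proof -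
  have sym: "transpose A = A" and pos: "\<And>x. x \<noteq> 0 \<Longrightarrow> x \<bullet> (A *v x) > 0"
    using A by (auto simp: positive_definite_def)
  have "\<exists>S. finite S \<and> card S = k \<and> (\<forall>u\<in>S. \<forall>v\<in>S. u \<bullet> (A *v v) = (if u = v then 1 else 0))"
    if "k \<le> CARD('n)" for k
    using that
  proof (induction k)
    case 0
    show ?case by (intro exI[of _ "{}"]) simp
  next
    case (Suc k)
    then obtain S where S: "finite S" "card S = k"
      "\<And>u v. u \<in> S \<Longrightarrow> v \<in> S \<Longrightarrow> u \<bullet> (A *v v) = (if u = v then 1 else 0)"
      by auto
    have "dim (((*v) A) ` S) \<le> card (((*v) A) ` S)"
      using S by (intro dim_le_card') simp
    also have "\<dots> \<le> k" using S card_image_le by blast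
    finally have "span (((*v) A) ` S) \<noteq> UNIV"
      using Suc.prems by (metis dim_span dim_UNIV DIM_cart DIM_real mult.right_neutral not_less_eq_eq order_trans)
    \<comment> \<open>A vector that is Euclidean-orthogonal to the images \<open>A *v s\<close> is \<open>A\<close>-orthogonal
      to the vectors \<open>s\<close> found so far, so no projection has to be subtracted.\<close>
    then obtain a where a: "a \<noteq> 0" "\<And>x. x \<in> span (((*v) A) ` S) \<Longrightarrow> a \<bullet> x = 0"
      using span_not_UNIV_orthogonal by blast
    define e where "e = (1 / sqrt (a \<bullet> (A *v a))) *\<^sub>R a"
    have ee: "e \<bullet> (A *v e) = 1"
      using pos[OF a(1)] by (simp add: e_def matrix_vector_mult_scaleR)
    have eS: "e \<bullet> (A *v s) = 0" "s \<bullet> (A *v e) = 0" if "s \<in> S" for s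
    proof -
      show "e \<bullet> (A *v s) = 0"
        using a(2)[of "A *v s"] that by (simp add: e_def span_base)
      then show "s \<bullet> (A *v e) = 0"
        by (metis symmetric_inner[OF sym] inner_commute)
    qed
    have "e \<notin> S" using ee eS by force
    with S ee eS Suc.prems show ?case
      by (intro exI[of _ "insert e S"]) auto
  qed
  from this[of "CARD('n)"] obtain S where S: "finite S" "card S = CARD('n)"
      "\<And>u v. u \<in> S \<Longrightarrow> v \<in> S \<Longrightarrow> u \<bullet> (A *v v) = (if u = v then 1 else 0)"
    by auto
  obtain h where h: "bij_betw h (UNIV::'n set) S"
    using S finite_same_card_bij[of "UNIV::'n set" S] by auto
  define C :: "real^'n^'n" where "C = (\<chi> i j. h j $ i)"
  have "(transpose C ** A ** C) $ i $ j = h i \<bullet> (A *v h j)" for i j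
    by (simp add: C_def matrix_mul_assoc[symmetric])
       (simp add: matrix_matrix_mult_def transpose_def inner_vec_def matrix_vector_mult_def)
  moreover have "h i \<bullet> (A *v h j) = mat 1 $ i $ j" for i j
    using S(3)[of "h i" "h j"] h by (auto simp: mat_def bij_betw_def inj_eq)
  ultimately have "transpose C ** A ** C = mat 1"
    by (simp add: vec_eq_iff)
  then show thesis by (rule that)
qed

lemma gaussian_standard_eq:
  "gaussian 0 (mat 1 :: real^'n^'n) = density lborel (\<lambda>x. ennreal (\<Prod>b\<in>Basis. std_normal_density (x \<bullet> b)))"
proof -
  have "matrix_inv (mat 1 :: real^'n^'n) = mat 1"
    by (rule matrix_inv_eqI) simp
  then have "gaussian 0 (mat 1 :: real^'n^'n) =
      density lborel (\<lambda>x. ennreal (exp (- (x \<bullet> x) / 2) / sqrt ((2 * pi) ^ CARD('n))))"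
    by (simp only: gaussian_def matrix_vector_mul_lid diff_zero det_I mult_1_right)
  moreover have "exp (- (x \<bullet> x) / 2) / sqrt ((2 * pi) ^ CARD('n)) = (\<Prod>b\<in>Basis. std_normal_density (x \<bullet> b))"
    for x :: "real^'n"
  proof -
    have "- (x \<bullet> x) / 2 = (\<Sum>b\<in>Basis. - (x \<bullet> b)\<^sup>2 / 2)"
      by (subst euclidean_inner) (simp add: power2_eq_square sum_negf sum_divide_distrib)
    then have "exp (- (x \<bullet> x) / 2) = (\<Prod>b\<in>Basis. exp (- (x \<bullet> b)\<^sup>2 / 2))"
      by (simp only: exp_sum[OF finite_Basis])
    moreover have "1 / sqrt ((2 * pi) ^ CARD('n)) = (\<Prod>b\<in>(Basis :: (real^'n) set). 1 / sqrt (2 * pi))"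
      by (simp only: prod_constant DIM_cart DIM_real mult_1_right real_sqrt_power power_one_over)
    ultimately show ?thesis
      by (simp only: std_normal_density_def prod.distrib divide_inverse mult.commute mult_1_left)
  qed
  ultimately show ?thesis
    by (simp only:)
qed

lemma nn_integral_gaussian_standard_prod:
  fixes h :: "real^'n \<Rightarrow> real \<Rightarrow> real"
  assumes h: "\<And>b. b \<in> Basis \<Longrightarrow> integrable lborel (\<lambda>t. std_normal_density t * h b t)"
    and h0: "\<And>b t. 0 \<le> h b t" and [measurable]: "\<And>b. h b \<in> borel_measurable borel"
  shows "(\<integral>\<^sup>+x. ennreal (\<Prod>b\<in>Basis. h b (x \<bullet> b)) \<partial>gaussian 0 (mat 1 :: real^'n^'n)) =
    ennreal (\<Prod>b\<in>Basis. \<integral>t. std_normal_density t * h b t \<partial>lborel)"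
proof -
  have "(\<integral>\<^sup>+x. ennreal (\<Prod>b\<in>Basis. h b (x \<bullet> b)) \<partial>gaussian 0 (mat 1 :: real^'n^'n)) =
    (\<integral>\<^sup>+x. (\<Prod>b\<in>Basis. ennreal (std_normal_density (x \<bullet> b) * h b (x \<bullet> b))) \<partial>lborel)"
  proof (unfold gaussian_standard_eq, subst nn_integral_density)
    have "ennreal (\<Prod>b\<in>Basis. std_normal_density (x \<bullet> b)) * ennreal (\<Prod>b\<in>Basis. h b (x \<bullet> b)) =
      ennreal (\<Prod>b\<in>Basis. std_normal_density (x \<bullet> b) * h b (x \<bullet> b))" for x :: "real^'n"
      by (subst prod.distrib, rule ennreal_mult[symmetric]) (auto intro!: prod_nonneg h0)
    then show "(\<integral>\<^sup>+x. ennreal (\<Prod>b\<in>Basis. std_normal_density (x \<bullet> b)) * ennreal (\<Prod>b\<in>Basis. h b (x \<bullet> b)) \<partial>lborel) =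
      (\<integral>\<^sup>+x. (\<Prod>b\<in>Basis. ennreal (std_normal_density (x \<bullet> b) * h b (x \<bullet> b))) \<partial>lborel)"
      using h0 by (simp only: prod_ennreal mult_nonneg_nonneg normal_density_nonneg)
  qed measurable
  also have "\<dots> = (\<Prod>b\<in>Basis. \<integral>\<^sup>+t. ennreal (std_normal_density t * h b t) \<partial>lborel)"
    using h0 by (intro nn_integral_lborel_prod[where f = "\<lambda>b t. ennreal (std_normal_density t * h b t)"]) simp_all
  also have "\<dots> = (\<Prod>b\<in>Basis. ennreal (\<integral>t. std_normal_density t * h b t \<partial>lborel))"
    using h h0 by (intro prod.cong refl nn_integral_eq_integral) auto
  also have "\<dots> = ennreal (\<Prod>b\<in>Basis. \<integral>t. std_normal_density t * h b t \<partial>lborel)"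
    using h0 by (intro prod_ennreal) auto
  finally show ?thesis .
qed

lemma space_gaussian [simp]: "space (gaussian m \<Sigma>) = UNIV"
  and sets_gaussian [simp, measurable_cong]: "sets (gaussian m \<Sigma>) = sets borel"
  by (simp_all add: gaussian_def)

lemma prob_space_gaussian_standard: "prob_space (gaussian 0 (mat 1 :: real^'n^'n))"
proof (rule prob_spaceI)
  show "emeasure (gaussian 0 (mat 1 :: real^'n^'n)) (space (gaussian 0 (mat 1 :: real^'n^'n))) = 1"
    using nn_integral_gaussian_standard_prod[where 'n = 'n, of "\<lambda>_ _. 1"] by simp
qed

text \<open>
  A coordinate of the standard Gaussian is a standard normal variable, whose first absolute moment is
  finite: weight the product density with \<open>\<bar>t\<bar>\<close> in that coordinate and with \<open>1\<close> in the others.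
\<close>

lemma integrable_gaussian_standard: "integrable (gaussian 0 (mat 1 :: real^'n^'n)) (\<lambda>x. x)"
proof -
  let ?M = "gaussian 0 (mat 1 :: real^'n^'n)"
  have "integrable ?M (\<lambda>x. x \<bullet> b)" if b: "b \<in> Basis" for b
  proof -
    define h where "h = (\<lambda>e t. if e = b then \<bar>t\<bar> else (1::real))"
    have h: "(\<integral>\<^sup>+x. ennreal (\<Prod>e\<in>Basis. h e (x \<bullet> e)) \<partial>?M) < \<infinity>"
    proof (subst nn_integral_gaussian_standard_prod)
      show "integrable lborel (\<lambda>t. std_normal_density t * h e t)" for e
        using integrable_std_normal_moment_abs[of 1] by (cases "e = b") (auto simp: h_def)
    qed (auto simp: h_def)
    have "(\<Prod>e\<in>Basis. h e (x \<bullet> e)) = \<bar>x \<bullet> b\<bar>" for x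
      using b by (simp add: h_def if_distrib prod.delta[of _ b "\<lambda>e. \<bar>x \<bullet> e\<bar>"])
    with h have "(\<integral>\<^sup>+x. ennreal (norm (x \<bullet> b)) \<partial>?M) < \<infinity>"
      by simp
    then show ?thesis by (intro integrableI_bounded) auto
  qed
  then have "integrable ?M (\<lambda>x. \<Sum>b\<in>Basis. (x \<bullet> b) *\<^sub>R b)"
    by (intro Bochner_Integration.integrable_sum integrable_scaleR_left) auto
  then show ?thesis by (simp add: euclidean_representation)
qed

text \<open>
  If \<open>A \<Sigma> A\<^sup>T\<close> is the identity, then \<open>\<Sigma>\<^sup>-\<^sup>1 = A\<^sup>T A\<close>, so the quadratic form in the density of the Gaussian is the
  squared norm of \<open>A (x - m)\<close>. Moreover \<open>det \<Sigma> = 1 / (det A)\<^sup>2\<close>, and the normalizing factor supplies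
  just the Jacobian of \<open>A\<close>. The inverse \<open>B\<close> serves to carry integrability back from the standard Gaussian.
\<close>

lemma gaussian_whitening:
  fixes \<Sigma> :: "real^'n^'n"
  assumes \<Sigma>: "positive_definite \<Sigma>"
  obtains A B :: "real^'n^'n" where "B ** A = mat 1"
    and "\<And>m. distr (gaussian m \<Sigma>) borel (\<lambda>x. A *v (x - m)) = gaussian 0 (mat 1)"
proof -
  obtain C :: "real^'n^'n" where C: "transpose C ** \<Sigma> ** C = mat 1"
    by (rule positive_definite_congruent_mat_1[OF \<Sigma>])
  define A where "A = transpose C"
  have 1: "A ** (\<Sigma> ** transpose A) = mat 1"
    unfolding A_def transpose_transpose matrix_mul_assoc by (rule C)
  then have BA: "(\<Sigma> ** transpose A) ** A = mat 1"
    by (rule matrix_left_right_inverse[THEN iffD1])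
  then have "\<Sigma> ** (transpose A ** A) = mat 1"
    by (simp only: matrix_mul_assoc)
  then have "(transpose A ** A) ** \<Sigma> = mat 1"
    by (rule matrix_left_right_inverse[THEN iffD1])
  then have inv: "matrix_inv \<Sigma> = transpose A ** A"
    by (rule matrix_inv_eqI)
  have q: "x \<bullet> (matrix_inv \<Sigma> *v x) = (A *v x) \<bullet> (A *v x)" for x
    unfolding inv by (rule inner_gram)
  have "det (A ** (\<Sigma> ** transpose A)) = 1" using 1 by simp
  then have d: "(det A)\<^sup>2 * det \<Sigma> = 1"
    by (simp add: det_mul power2_eq_square algebra_simps)
  then have A0: "det A \<noteq> 0" by auto
  with d have "det \<Sigma> = 1 / (det A)\<^sup>2" by (simp add: field_simps)
  then have sd: "sqrt (det \<Sigma>) = 1 / \<bar>det A\<bar>" by (simp add: real_sqrt_divide)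
  define D where "D y = exp (- (y \<bullet> y) / 2) / sqrt ((2 * pi) ^ CARD('n))" for y :: "real^'n"
  have [measurable]: "D \<in> borel_measurable borel"
    unfolding D_def by measurable
  have std: "gaussian 0 (mat 1 :: real^'n^'n) = density lborel (\<lambda>y. ennreal (D y))"
    by (simp add: gaussian_def D_def matrix_inv_eqI[of "mat 1" "mat 1"])
  have gs: "gaussian m \<Sigma> = density lborel (\<lambda>x. ennreal \<bar>det A\<bar> * ennreal (D (A *v (x - m))))" for m
  proof -
    have "exp (- ((x - m) \<bullet> (matrix_inv \<Sigma> *v (x - m))) / 2) / sqrt ((2 * pi) ^ CARD('n) * det \<Sigma>) =
      \<bar>det A\<bar> * D (A *v (x - m))" for x
      by (simp only: q D_def real_sqrt_mult[of _ "det \<Sigma>"] sd) simp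
    moreover have "D y \<ge> 0" for y by (simp add: D_def)
    ultimately show ?thesis
      by (simp only: gaussian_def ennreal_mult abs_ge_zero)
  qed
  have "distr (gaussian m \<Sigma>) borel (\<lambda>x. A *v (x - m)) = gaussian 0 (mat 1)" for m
  proof (rule measure_eqI)
    fix S :: "(real^'n) set"
    assume "S \<in> sets (distr (gaussian m \<Sigma>) borel (\<lambda>x. A *v (x - m)))"
    then have [measurable]: "S \<in> sets borel" by simp
    let ?g = "\<lambda>y. ennreal (D y) * indicator S y"
    have "emeasure (distr (gaussian m \<Sigma>) borel (\<lambda>x. A *v (x - m))) S =
      (\<integral>\<^sup>+x. indicator S (A *v (x - m)) \<partial>gaussian m \<Sigma>)"
      by (subst nn_integral_indicator[symmetric], simp, subst nn_integral_distr) auto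
    also have "\<dots> = (\<integral>\<^sup>+x. ennreal \<bar>det A\<bar> * ?g (A *v (x - m)) \<partial>lborel)"
      unfolding gs by (subst nn_integral_density) (auto simp: mult.assoc)
    also have "\<dots> = (\<integral>\<^sup>+x. ennreal \<bar>det A\<bar> * ?g (A *v x) \<partial>lborel)"
      using nn_integral_lborel_translate[of "\<lambda>x. ennreal \<bar>det A\<bar> * ?g (A *v x)" "- m"] by simp
    also have "\<dots> = (\<integral>\<^sup>+y. ?g y \<partial>lborel)"
      using nn_integral_lborel_matrix[OF _ A0, of ?g] by (simp add: nn_integral_cmult)
    also have "\<dots> = emeasure (gaussian 0 (mat 1)) S"
      unfolding std by (simp add: emeasure_density)
    finally show "emeasure (distr (gaussian m \<Sigma>) borel (\<lambda>x. A *v (x - m))) S = emeasure (gaussian 0 (mat 1)) S" .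
  qed simp
  with BA show thesis by (rule that)
qed

lemma prob_space_gaussian:
  fixes \<Sigma> :: "real^'n^'n"
  assumes "positive_definite \<Sigma>"
  shows "prob_space (gaussian m \<Sigma>)"
proof -
  obtain A :: "real^'n^'n" where A: "distr (gaussian m \<Sigma>) borel (\<lambda>x. A *v (x - m)) = gaussian 0 (mat 1)"
    by (rule gaussian_whitening[OF assms]) blast
  show ?thesis
    by (rule prob_space_distrD[of "\<lambda>x. A *v (x - m)" _ borel])
       (auto simp: A prob_space_gaussian_standard)
qed

lemma integrable_gaussian:
  fixes \<Sigma> :: "real^'n^'n"
  assumes "positive_definite \<Sigma>"
  shows "integrable (gaussian m \<Sigma>) (\<lambda>x. x)"
proof -
  obtain A B :: "real^'n^'n" where BA: "B ** A = mat 1"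
    and A: "distr (gaussian m \<Sigma>) borel (\<lambda>x. A *v (x - m)) = gaussian 0 (mat 1)"
    by (rule gaussian_whitening[OF assms]) blast
  interpret prob_space "gaussian m \<Sigma>" by (rule prob_space_gaussian[OF assms])
  have "integrable (distr (gaussian m \<Sigma>) borel (\<lambda>x. A *v (x - m))) (\<lambda>x. x)"
    unfolding A by (rule integrable_gaussian_standard)
  then have "integrable (gaussian m \<Sigma>) (\<lambda>x. A *v (x - m))"
    by (subst (asm) integrable_distr_eq) auto
  then have "integrable (gaussian m \<Sigma>) (\<lambda>x. B *v (A *v (x - m)))"
    by (rule integrable_bounded_linear[OF matrix_vector_mul_bounded_linear])
  then have "integrable (gaussian m \<Sigma>) (\<lambda>x. x - m)"
    by (simp add: matrix_vector_mul_assoc BA)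
  then have "integrable (gaussian m \<Sigma>) (\<lambda>x. (x - m) + m)"
    by (intro Bochner_Integration.integrable_add) auto
  then show ?thesis by simp
qed

lemma gaussian_translate:
  "gaussian m' \<Sigma> = distr (gaussian m \<Sigma>) borel (\<lambda>x. x + (m' - m))"
proof (rule measure_eqI)
  fix S assume "S \<in> sets (gaussian m' \<Sigma>)"
  then have [measurable]: "S \<in> sets borel" by simp
  define D where "D y = ennreal (exp (- (y \<bullet> (matrix_inv \<Sigma> *v y)) / 2) / sqrt ((2 * pi) ^ CARD('a) * det \<Sigma>))" for y :: "real^'a"
  have [measurable]: "D \<in> borel_measurable borel" unfolding D_def by measurable
  have g: "gaussian m \<Sigma> = density lborel (\<lambda>x. D (x - m))" for m
    by (simp add: gaussian_def D_def)
  have "emeasure (gaussian m' \<Sigma>) S = (\<integral>\<^sup>+x. D (x - m') * indicator S x \<partial>lborel)"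
    unfolding g by (simp add: emeasure_density)
  also have "\<dots> = (\<integral>\<^sup>+x. D (x + (m' - m) - m') * indicator S (x + (m' - m)) \<partial>lborel)"
    using nn_integral_lborel_translate[of "\<lambda>x. D (x - m') * indicator S x" "m' - m"] by simp
  also have "\<dots> = (\<integral>\<^sup>+x. indicator S (x + (m' - m)) \<partial>gaussian m \<Sigma>)"
    unfolding g by (subst nn_integral_density) (auto simp: algebra_simps)
  also have "\<dots> = emeasure (distr (gaussian m \<Sigma>) borel (\<lambda>x. x + (m' - m))) S"
    by (subst nn_integral_indicator[symmetric], simp, subst nn_integral_distr) auto
  finally show "emeasure (gaussian m' \<Sigma>) S = emeasure (distr (gaussian m \<Sigma>) borel (\<lambda>x. x + (m' - m))) S" .
qed simp

text \<open>
  The translation is moved through \<open>f\<close> instead of being read off from densities, which the pushforwards lack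
  when \<open>A\<close> is singular.
\<close>

lemma affine_gaussian_translate:
  fixes A :: "real^'n^'n"
  assumes f: "\<And>x. f x = A *v x + b"
  shows "distr (gaussian m' \<Sigma>) borel f = distr (distr (gaussian m \<Sigma>) borel f) borel (\<lambda>x. x + (f m' - f m))"
proof -
  have [measurable]: "f \<in> borel_measurable borel" unfolding f by measurable
  show ?thesis
    by (subst gaussian_translate[of m' \<Sigma> m], subst (1 2) distr_distr)
       (auto simp: f comp_def matrix_vector_right_distrib matrix_vector_mult_diff_distrib algebra_simps intro!: distr_cong)
qed

section \<open>Optimal transport between translates\<close>

text \<open>
  The displacement \<open>S x - x\<close> has mean \<open>v\<close>, whatever \<open>S\<close> is, because the two means are determined by the
  marginals. So the integral of \<open>(norm (S x - x - v))\<^sup>2\<close> is the cost of \<open>S\<close> minus \<open>(norm v)\<^sup>2\<close>, and it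
  vanishes when \<open>S\<close> is no more expensive than the translation.
\<close>

lemma pushforward_translation_cheap_imp_AE:
  fixes \<mu> :: "(real^'n) measure"
  assumes "prob_space \<mu>" and sets[measurable_cong]: "sets \<mu> = sets borel" and int: "integrable \<mu> (\<lambda>x. x)"
    and S[measurable]: "S \<in> borel_measurable borel"
    and push: "distr \<mu> borel S = distr \<mu> borel (\<lambda>x. x + v)"
    and cheap: "transport_cost \<mu> S \<le> ennreal ((norm v)\<^sup>2)"
  shows "AE x in \<mu>. S x - x = v"
proof -
  interpret prob_space \<mu> by fact
  have iv: "integrable \<mu> (\<lambda>x. x + v)" using int by simp
  then have "integrable (distr \<mu> borel S) (\<lambda>x. x)"
    unfolding push by (subst integrable_distr_eq) auto
  then have iS: "integrable \<mu> S"
    by (subst (asm) integrable_distr_eq) auto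
  have "(\<integral>x. S x \<partial>\<mu>) = (\<integral>y. y \<partial>distr \<mu> borel S)"
    by (subst integral_distr) auto
  also have "\<dots> = (\<integral>x. x + v \<partial>\<mu>)"
    unfolding push by (subst integral_distr) auto
  also have "\<dots> = (\<integral>x. x \<partial>\<mu>) + v"
    using int by (simp add: prob_space)
  finally have mean: "(\<integral>x. S x - x \<partial>\<mu>) = v"
    using iS int by simp
  have iD: "integrable \<mu> (\<lambda>x. S x - x)" using iS int by simp
  have sq: "integrable \<mu> (\<lambda>x. (norm (S x - x))\<^sup>2)"
    using cheap unfolding transport_cost_def
    by (intro integrableI_nonneg) (auto intro: le_less_trans)
  have "ennreal (\<integral>x. (norm (S x - x))\<^sup>2 \<partial>\<mu>) \<le> ennreal ((norm v)\<^sup>2)"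
    using cheap sq unfolding transport_cost_def by (subst nn_integral_eq_integral[symmetric]) auto
  then have cost: "(\<integral>x. (norm (S x - x))\<^sup>2 \<partial>\<mu>) \<le> (norm v)\<^sup>2"
    by (simp add: ennreal_le_iff)
  have expand: "(norm (S x - x - v))\<^sup>2 = (norm (S x - x))\<^sup>2 - 2 * (v \<bullet> (S x - x)) + (norm v)\<^sup>2" for x
    by (simp only: power2_norm_eq_inner) (simp add: inner_diff_left inner_diff_right inner_commute)
  have i: "integrable \<mu> (\<lambda>x. (norm (S x - x - v))\<^sup>2)"
    unfolding expand using sq iD by (intro Bochner_Integration.integrable_add Bochner_Integration.integrable_diff) auto
  have "(\<integral>x. (norm (S x - x - v))\<^sup>2 \<partial>\<mu>) = (\<integral>x. (norm (S x - x))\<^sup>2 \<partial>\<mu>) - 2 * (v \<bullet> (\<integral>x. S x - x \<partial>\<mu>)) + (norm v)\<^sup>2"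
    unfolding expand using sq iD by (simp add: prob_space)
  also have "\<dots> \<le> 0"
    using cost by (simp add: mean power2_norm_eq_inner)
  finally have "(\<integral>x. (norm (S x - x - v))\<^sup>2 \<partial>\<mu>) = 0"
    by (intro antisym) auto
  then have "AE x in \<mu>. (norm (S x - x - v))\<^sup>2 = 0"
    using i by (subst (asm) integral_nonneg_eq_0_iff_AE) auto
  then show ?thesis by eventually_elim simp
qed

lemma transport_cost_AE_translation:
  assumes "prob_space \<mu>" and AE: "AE x in \<mu>. S x - x = v"
  shows "transport_cost \<mu> S = ennreal ((norm v)\<^sup>2)"
proof -
  interpret prob_space \<mu> by fact
  have "transport_cost \<mu> S = (\<integral>\<^sup>+x. ennreal ((norm v)\<^sup>2) \<partial>\<mu>)"
    unfolding transport_cost_def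
  proof (rule nn_integral_cong_AE)
    show "AE x in \<mu>. ennreal ((norm (S x - x))\<^sup>2) = ennreal ((norm v)\<^sup>2)"
      using AE by eventually_elim simp
  qed
  then show ?thesis by (simp add: emeasure_space_1)
qed

text \<open>
  The translation is optimal, since a cheaper map would equal it almost everywhere; so the choice made by
  \<^const>\<open>ot_map\<close> is an optimal map, and being no more expensive it too is the translation almost everywhere.
\<close>

lemma ot_disp_translation:
  fixes \<mu> :: "(real^'n) measure" and v :: "real^'n"
  assumes \<mu>: "prob_space \<mu>" and sets: "sets \<mu> = sets borel" and int: "integrable \<mu> (\<lambda>x. x)"
  defines "\<nu> \<equiv> distr \<mu> borel (\<lambda>x. x + v)"
  shows "ot_disp \<mu> \<nu> \<in> borel_measurable borel" and "AE x in \<mu>. ot_disp \<mu> \<nu> x = v"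
proof -
  have tr: "transport_cost \<mu> (\<lambda>x. x + v) = ennreal ((norm v)\<^sup>2)"
    using \<mu> by (intro transport_cost_AE_translation) auto
  have "is_ot_map \<mu> \<nu> (\<lambda>x. x + v)"
    unfolding is_ot_map_def tr
  proof (intro conjI allI impI)
    fix S assume S: "S \<in> borel_measurable borel \<and> distr \<mu> borel S = \<nu>"
    show "ennreal ((norm v)\<^sup>2) \<le> transport_cost \<mu> S"
    proof (cases "transport_cost \<mu> S \<le> ennreal ((norm v)\<^sup>2)")
      case True
      then have "AE x in \<mu>. S x - x = v"
        using S by (intro pushforward_translation_cheap_imp_AE[OF \<mu> sets int]) (auto simp: \<nu>_def)
      then show ?thesis using transport_cost_AE_translation[OF \<mu>] by simp
    qed auto
  qed (auto simp: \<nu>_def)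
  then have "is_ot_map \<mu> \<nu> (ot_map \<mu> \<nu>)"
    unfolding ot_map_def by (rule someI[of "is_ot_map \<mu> \<nu>"])
  then have T: "ot_map \<mu> \<nu> \<in> borel_measurable borel" "distr \<mu> borel (ot_map \<mu> \<nu>) = \<nu>"
    and min: "\<And>S. S \<in> borel_measurable borel \<Longrightarrow> distr \<mu> borel S = \<nu> \<Longrightarrow>
      transport_cost \<mu> (ot_map \<mu> \<nu>) \<le> transport_cost \<mu> S"
    by (auto simp: is_ot_map_def)
  show "ot_disp \<mu> \<nu> \<in> borel_measurable borel"
    unfolding ot_disp_def using T by measurable
  have "transport_cost \<mu> (ot_map \<mu> \<nu>) \<le> ennreal ((norm v)\<^sup>2)"
    using min[of "\<lambda>x. x + v"] by (simp add: tr \<nu>_def)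
  then show "AE x in \<mu>. ot_disp \<mu> \<nu> x = v"
    unfolding ot_disp_def using T
    by (intro pushforward_translation_cheap_imp_AE[OF \<mu> sets int]) (auto simp: \<nu>_def)
qed

section \<open>The Wasserstein Mahalanobis distance\<close>

lemma l2_inner_AE_const:
  fixes \<mu> :: "(real^'n) measure"
  assumes "prob_space \<mu>" and "\<psi> \<in> borel_measurable \<mu>" "\<phi> \<in> borel_measurable \<mu>"
    and "AE x in \<mu>. \<psi> x = v" "AE x in \<mu>. \<phi> x = w"
  shows "l2_inner \<mu> \<psi> \<phi> = v \<bullet> w"
proof -
  interpret prob_space \<mu> by fact
  have "l2_inner \<mu> \<psi> \<phi> = (\<integral>x. v \<bullet> w \<partial>\<mu>)"
    unfolding l2_inner_def
    using assms by (intro integral_cong_AE) (auto elim: AE_mp)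
  then show ?thesis by (simp add: prob_space)
qed

text \<open>
  Up to null sets the displacements are the columns of \<open>V\<close>. So the matrix \<open>B\<close> is \<open>V\<^sup>T C V\<close> with the
  Euclidean covariance \<open>C\<close> of these vectors, and \<open>F\<^sup>\<dagger>\<close> sends a constant \<open>w\<close> to \<open>V B\<^sup>\<dagger> V\<^sup>T w\<close>, which
  \<open>pinv_gram_sandwich\<close> identifies as \<open>C\<^sup>\<dagger> w\<close>.
\<close>

lemma wm_F_pinv_form_AE_const:
  fixes \<mu> :: "(real^'n) measure" and \<mu>s :: "'k::finite \<Rightarrow> (real^'n) measure"
  assumes \<mu>: "prob_space \<mu>"
    and gm: "\<And>i. ot_disp \<mu> (\<mu>s i) \<in> borel_measurable \<mu>"
    and g: "\<And>i. AE x in \<mu>. ot_disp \<mu> (\<mu>s i) x = ps i - p"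
    and \<phi>m: "\<phi> \<in> borel_measurable \<mu>" and \<phi>: "AE x in \<mu>. \<phi> x = w"
  shows "l2_inner \<mu> \<phi> (wm_F_pinv \<mu> \<mu>s \<phi>) = w \<bullet> (pinv (local_cov p ps) *v w)"
proof -
  note [measurable] = gm \<phi>m
  define V :: "real^'k^'n" where "V = (\<chi> a i. (ps i - p) $ a)"
  define C where "C = local_cov p ps"
  have C: "C = (1 / real CARD('k)) *\<^sub>R (V ** transpose V)"
    by (simp add: C_def local_cov_def V_def matrix_matrix_mult_def transpose_def vec_eq_iff)
  have l: "l2_inner \<mu> (ot_disp \<mu> (\<mu>s i)) (ot_disp \<mu> (\<mu>s j)) = (ps i - p) \<bullet> (ps j - p)" for i j
    by (rule l2_inner_AE_const[OF \<mu> gm gm g g])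
  have l\<phi>: "l2_inner \<mu> (ot_disp \<mu> (\<mu>s i)) \<phi> = (ps i - p) \<bullet> w" for i
    by (rule l2_inner_AE_const[OF \<mu> gm \<phi>m g \<phi>])
  have allg: "AE x in \<mu>. \<forall>i. ot_disp \<mu> (\<mu>s i) x = ps i - p"
    using g by (simp add: AE_all_countable)
  have Vcol: "(V *v y) = (\<Sum>i\<in>UNIV. y $ i *\<^sub>R (ps i - p))" for y
    by (simp add: V_def matrix_vector_mult_def vec_eq_iff mult.commute)
  have VT: "(transpose V *v y) $ i = (ps i - p) \<bullet> y" for y i
    by (simp add: V_def transpose_def matrix_vector_mult_def inner_vec_def)
  have Vaxis: "V *v axis j 1 = ps j - p" for j
    by (simp add: V_def matrix_vector_mult_basis column_def vec_eq_iff)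
  have F: "AE x in \<mu>. wm_F \<mu> \<mu>s (ot_disp \<mu> (\<mu>s j)) x = C *v (ps j - p)" for j
  proof -
    have Cv: "C *v (ps j - p) = (1 / real CARD('k)) *\<^sub>R (\<Sum>i\<in>UNIV. ((ps i - p) \<bullet> (ps j - p)) *\<^sub>R (ps i - p))"
      by (simp add: C scaleR_matrix_vector_assoc[symmetric] matrix_vector_mul_assoc[symmetric] Vcol VT del: transpose_matrix_vector)
    show ?thesis
      using allg by eventually_elim (simp add: wm_F_def l Cv)
  qed
  have "wm_B \<mu> \<mu>s $ i $ j = (transpose V ** C ** V) $ i $ j" for i j
  proof -
    have "wm_B \<mu> \<mu>s $ i $ j = (C *v (ps j - p)) \<bullet> (ps i - p)"
      unfolding wm_B_def
      by (simp, rule l2_inner_AE_const[OF \<mu> _ gm F g]) (simp add: wm_F_def)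
    also have "\<dots> = (transpose V *v (C *v (V *v axis j 1))) $ i"
      by (simp add: VT Vaxis inner_commute del: transpose_matrix_vector)
    also have "\<dots> = ((transpose V ** C ** V) *v axis j 1) $ i"
      by (simp only: matrix_vector_mul_assoc matrix_mul_assoc)
    also have "\<dots> = (transpose V ** C ** V) $ i $ j"
      by (simp add: matrix_vector_mult_basis column_def)
    finally show ?thesis .
  qed
  then have B: "wm_B \<mu> \<mu>s = transpose V ** C ** V"
    by (simp add: vec_eq_iff)
  have "pinv C *v w = V *v (pinv (wm_B \<mu> \<mu>s) *v (transpose V *v w))"
    using pinv_gram_sandwich[OF _ C]
    by (simp add: B matrix_vector_mul_assoc matrix_mul_assoc del: transpose_matrix_vector)
  also have "\<dots> = (\<Sum>i\<in>UNIV. \<Sum>j\<in>UNIV. (pinv (wm_B \<mu> \<mu>s) $ i $ j * ((ps j - p) \<bullet> w)) *\<^sub>R (ps i - p))"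
    by (simp add: Vcol VT matrix_vector_mult_def[of "pinv _"] scaleR_sum_left del: transpose_matrix_vector)
  finally have X: "pinv C *v w = \<dots>" .
  have "AE x in \<mu>. wm_F_pinv \<mu> \<mu>s \<phi> x = pinv C *v w"
    using allg by eventually_elim (simp add: wm_F_pinv_def l\<phi> X)
  then show ?thesis
    unfolding C_def[symmetric]
    by (intro l2_inner_AE_const[OF \<mu> \<phi>m _ \<phi>]) (simp_all add: wm_F_pinv_def)
qed

text \<open>
  One of the two summands of the squared distance. The two differ only in the base point, so the theorem
  uses this lemma once for each of them.
\<close>

lemma wm_form_affine_gaussian:
  fixes A \<Sigma> :: "real^'n^'n" and ms :: "'k::finite \<Rightarrow> real^'n"
  assumes f: "\<And>x. f x = A *v x + b" and \<Sigma>: "positive_definite \<Sigma>"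
  defines "\<gamma> \<equiv> \<lambda>m. distr (gaussian m \<Sigma>) borel f"
  shows "l2_inner (\<gamma> m) (ot_disp (\<gamma> m) (\<gamma> m')) (wm_F_pinv (\<gamma> m) (\<lambda>i. \<gamma> (ms i)) (ot_disp (\<gamma> m) (\<gamma> m'))) =
    (f m' - f m) \<bullet> (pinv (local_cov (f m) (\<lambda>i. f (ms i))) *v (f m' - f m))"
proof -
  have [measurable]: "f \<in> borel_measurable borel" unfolding f by measurable
  interpret prob_space "gaussian m \<Sigma>" by (rule prob_space_gaussian[OF \<Sigma>])
  have p: "prob_space (\<gamma> m)" unfolding \<gamma>_def by (rule prob_space_distr) simp
  have s: "sets (\<gamma> m) = sets borel" by (simp add: \<gamma>_def)
  have "integrable (gaussian m \<Sigma>) f"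
    unfolding f using integrable_bounded_linear[OF matrix_vector_mul_bounded_linear integrable_gaussian[OF \<Sigma>]]
    by (intro Bochner_Integration.integrable_add) auto
  then have i: "integrable (\<gamma> m) (\<lambda>x. x)"
    unfolding \<gamma>_def by (subst integrable_distr_eq) auto
  have t: "\<gamma> m'' = distr (\<gamma> m) borel (\<lambda>x. x + (f m'' - f m))" for m''
    unfolding \<gamma>_def by (rule affine_gaussian_translate[OF f])
  have "ot_disp (\<gamma> m) (\<gamma> m'') \<in> borel_measurable (\<gamma> m)" "AE x in \<gamma> m. ot_disp (\<gamma> m) (\<gamma> m'') x = f m'' - f m" for m''
    using ot_disp_translation[OF p s i, of "f m'' - f m"] unfolding t[of m'', symmetric]
    by (simp_all add: measurable_cong_sets[OF s refl])
  then show ?thesis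
    by (intro wm_F_pinv_form_AE_const p)
qed

theorem theorem2:
  fixes f :: "real^'n \<Rightarrow> real^'n"
    and \<Sigma> :: "real^'n^'n"
    and m\<alpha> m\<beta> :: "real^'n"
    and \<delta> :: real
    and P :: "'w measure"
    and M\<alpha> :: "'N::finite \<Rightarrow> 'w \<Rightarrow> real^'n"
    and M\<beta> :: "'K::finite \<Rightarrow> 'w \<Rightarrow> real^'n"
  assumes f_affine: "\<exists>A b. \<forall>x. f x = A *v x + b"
    and \<Sigma>: "positive_definite \<Sigma>"
    and \<delta>: "\<delta> > 0"
    and P: "prob_space P"
    and M\<alpha>_rv: "\<And>i. M\<alpha> i \<in> borel_measurable P"
    and M\<beta>_rv: "\<And>j. M\<beta> j \<in> borel_measurable P"
    and M\<alpha>_uniform: "\<And>i. distr P lborel (M\<alpha> i) = uniform_measure lborel (cball m\<alpha> \<delta>)"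
    and M\<beta>_uniform: "\<And>j. distr P lborel (M\<beta> j) = uniform_measure lborel (cball m\<beta> \<delta>)"
  shows "\<forall>\<omega>\<in>space P.
    mahalanobis_dist (f m\<alpha>) (\<lambda>i. f (M\<alpha> i \<omega>)) (f m\<beta>) (\<lambda>j. f (M\<beta> j \<omega>)) =
    wm_dist
      (distr (gaussian m\<alpha> \<Sigma>) borel f) (\<lambda>i. distr (gaussian (M\<alpha> i \<omega>) \<Sigma>) borel f)
      (distr (gaussian m\<beta> \<Sigma>) borel f) (\<lambda>j. distr (gaussian (M\<beta> j \<omega>) \<Sigma>) borel f)"
proof
  fix \<omega>
  obtain A b where f: "\<And>x. f x = A *v x + b" using f_affine by blast
  \<comment> \<open>The two displacements are opposite to each other, and a quadratic form does not see the sign.\<close>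
  define d where "d = f m\<alpha> - f m\<beta>"
  have neg: "f m\<beta> - f m\<alpha> = - d" by (simp add: d_def)
  have odd: "Q *v (- d) = - (Q *v d)" for Q :: "real^'n^'n"
    using linear_neg[OF matrix_vector_mul_linear] .
  show "mahalanobis_dist (f m\<alpha>) (\<lambda>i. f (M\<alpha> i \<omega>)) (f m\<beta>) (\<lambda>j. f (M\<beta> j \<omega>)) =
    wm_dist
      (distr (gaussian m\<alpha> \<Sigma>) borel f) (\<lambda>i. distr (gaussian (M\<alpha> i \<omega>) \<Sigma>) borel f)
      (distr (gaussian m\<beta> \<Sigma>) borel f) (\<lambda>j. distr (gaussian (M\<beta> j \<omega>) \<Sigma>) borel f)"
    unfolding mahalanobis_dist_def wm_dist_def wm_form_affine_gaussian[OF f \<Sigma>] neg d_def[symmetric]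
    by (simp add: odd matrix_vector_mult_add_rdistrib inner_add_right add.commute)
qed

end
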